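(* Let $n\ge 1$ and, for every $i\in[n]$, let $G_i$ be a connected $d_i$-regular graph on $m_i$ vertices (with $m_i$ finite). Let $\mathbf{G}:=G_1\square\cdots\square G_n$ and let $M:=\max_{i\in[n]}m_i$. Then, for every nonempty $A\subseteq V(\mathbf{G})$, $$e_{\mathbf{G}}(A,A^c)\ge|A|\cdot\frac{e}{M}\cdot\log\frac{|V(\mathbf{G})|}{|A|},$$ where on the right-hand side $e$ is Euler's number.
   Context: $\log$ is the natural logarithm and $[n]$ denotes $\{1,\dots,n\}$. For a graph $G$ and $A\subseteq V(G)$, $A^c=V(G)\setminus A$ and $e_G(A,A^c)$ is the number of edges of $G$ with exactly one endpoint in $A$. The product graph $G_1\square\cdots\square G_n$ has vertex set $V(G_1)\times\cdots\times V(G_n)$, and its edges are all pairs $\{u,v\}$ for which there is an index $j\in[n]$ such that $u_jv_j\in E(G_j)$ and $u_l=v_l$ for all $l\neq j$. *)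

theory Defs
  imports Complex_Main "HOL-Library.FuncSet"
begin

record 'a ugraph =
  verts :: "'a set"
  edges :: "'a set set"

definition simple_graph :: "'a ugraph \<Rightarrow> bool" where
  "simple_graph G \<longleftrightarrow> (\<forall>x\<in>edges G. x \<subseteq> verts G \<and> card x = 2)"

definition adjacent :: "'a ugraph \<Rightarrow> 'a \<Rightarrow> 'a \<Rightarrow> bool" where
  "adjacent G u v \<longleftrightarrow> {u, v} \<in> edges G"

definition connected_graph :: "'a ugraph \<Rightarrow> bool" where
  "connected_graph G \<longleftrightarrow>
     verts G \<noteq> {} \<and> (\<forall>u\<in>verts G. \<forall>v\<in>verts G. (adjacent G)\<^sup>*\<^sup>* u v)"

definition degree :: "'a ugraph \<Rightarrow> 'a \<Rightarrow> nat" where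
  "degree G v = card {x \<in> edges G. v \<in> x}"

definition regular_graph :: "'a ugraph \<Rightarrow> nat \<Rightarrow> bool" where
  "regular_graph G d \<longleftrightarrow> (\<forall>v\<in>verts G. degree G v = d)"

definition edge_boundary :: "'a ugraph \<Rightarrow> 'a set \<Rightarrow> 'a set set" where
  "edge_boundary G A = {x \<in> edges G. card (x \<inter> A) = 1}"

text \<open>Vertex tuples are extensional functions on \<open>{1..n}\<close>, so equal tuples are equal
  functions. All factors share one vertex type; this is no restriction for finite graphs.\<close>

definition product_graph :: "nat \<Rightarrow> (nat \<Rightarrow> 'a ugraph) \<Rightarrow> (nat \<Rightarrow> 'a) ugraph" where
  "product_graph n G =
     \<lparr>verts = (\<Pi>\<^sub>E i\<in>{1..n}. verts (G i)),
      edges = {{u, v} | u v.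
        u \<in> (\<Pi>\<^sub>E i\<in>{1..n}. verts (G i)) \<and> v \<in> (\<Pi>\<^sub>E i\<in>{1..n}. verts (G i)) \<and>
        (\<exists>j\<in>{1..n}. adjacent (G j) (u j) (v j) \<and> (\<forall>l\<in>{1..n}. l \<noteq> j \<longrightarrow> u l = v l))}\<rparr>"

end

theory Submission
  imports Defs
begin

text \<open>
  A connected graph on \<open>m\<close> vertices has an edge leaving any nonempty proper vertex set
  of size \<open>a\<close>, and \<open>a / m * ln (m / a) \<le> 1 / e\<close>, so a single factor satisfies the inequality by
  connectivity alone. Applying this on every axis-parallel fibre of \<open>A\<close> reduces the theorem to
  \<open>\<Sum>\<^sub>i H(X\<^sub>i | X\<^sub>j, j \<noteq> i) \<le> H(X)\<close> for \<open>X\<close> uniform on \<open>A\<close>.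
\<close>

section \<open>Entropy inequality for the fibre sizes\<close>

definition fibre :: "('i \<Rightarrow> 'a) set \<Rightarrow> 'i \<Rightarrow> ('i \<Rightarrow> 'a) \<Rightarrow> ('i \<Rightarrow> 'a) set" where
  "fibre A i x = {y\<in>A. y(i := undefined) = x(i := undefined)}"

lemma finite_fibre [simp]: "finite A \<Longrightarrow> finite (fibre A i x)"
  by (simp add: fibre_def)

lemma card_fibre_pos: "finite A \<Longrightarrow> x \<in> A \<Longrightarrow> card (fibre A i x) > 0"
  by (auto simp: fibre_def card_gt_0_iff)

text \<open>A point \<open>y\<close> of the fibre through \<open>x\<close> fixes \<open>x\<close>
  off \<open>i\<close>, and a point \<open>z\<close> of the slice fixes \<open>x i\<close>. So the
  pair \<open>(y, z)\<close> determines \<open>x\<close>, and the triples \<open>(x, y, z)\<close>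
  inject into \<open>A \<times> A\<close>.\<close>

lemma sum_fibre_times_slice_le:
  assumes "finite A"
  shows "(\<Sum>x\<in>A. card (fibre A i x) * card {z\<in>A. z i = x i}) \<le> card A * card A"
proof -
  let ?T = "SIGMA x:A. fibre A i x \<times> {z\<in>A. z i = x i}"
  have "inj_on snd ?T"
  proof (rule inj_onI)
    fix s t assume s: "s \<in> ?T" and t: "t \<in> ?T" and eq: "snd s = snd t"
    obtain x y z where s': "s = (x, y, z)" by (cases s) auto
    obtain x' where t': "t = (x', y, z)" using eq s' by (cases t) auto
    have "x(i := undefined) = x'(i := undefined)" "x i = x' i"
      using s t unfolding s' t' by (auto simp: fibre_def)
    then have "x = x'" by (metis fun_upd_triv fun_upd_upd)
    then show "s = t" by (simp add: s' t')
  qed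
  moreover have "snd ` ?T \<subseteq> A \<times> A" by (auto simp: fibre_def)
  ultimately have "card ?T \<le> card (A \<times> A)"
    using assms by (intro card_inj_on_le[of snd]) auto
  then show ?thesis using assms by (simp add: card_cartesian_product)
qed

text \<open>For nonempty \<open>A\<close> and X uniform on \<open>A\<close>, dividing by
  \<open>card A\<close> turns the two sums into H(X_i | X_j, j \<noteq> i) and H(X | X_i). Hence
  this is the fact that conditioning does not increase the entropy of X_i. The counting bound above
  implies it through \<open>ln t \<le> t - 1\<close>.\<close>

lemma sum_ln_fibre_slice_le:
  assumes "finite A"
  shows "(\<Sum>x\<in>A. ln (real (card (fibre A i x))) + ln (real (card {z\<in>A. z i = x i})))
    \<le> real (card A) * ln (real (card A))"
proof (cases "A = {}")
  case False
  define N where "N = real (card A)"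
  have N: "N > 0" using False assms by (simp add: N_def card_gt_0_iff)
  define f where "f x = real (card (fibre A i x))" for x
  define s where "s x = real (card {z\<in>A. z i = x i})" for x
  have f: "f x > 0" and s: "s x > 0" if "x \<in> A" for x
    using that assms card_fibre_pos[OF assms that] by (auto simp: f_def s_def card_gt_0_iff)
  have "(\<Sum>x\<in>A. ln (f x) + ln (s x) - ln N) \<le> (\<Sum>x\<in>A. f x * s x / N - 1)"
  proof (rule sum_mono)
    fix x assume x: "x \<in> A"
    have "ln (f x * s x / N) = ln (f x) + ln (s x) - ln N"
      using f[OF x] s[OF x] N by (simp add: ln_div ln_mult)
    then show "ln (f x) + ln (s x) - ln N \<le> f x * s x / N - 1"
      using ln_le_minus_one[of "f x * s x / N"] f[OF x] s[OF x] N by simp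
  qed
  also have "\<dots> = (\<Sum>x\<in>A. f x * s x) / N - N"
    by (simp add: sum_subtractf sum_divide_distrib N_def)
  also have "\<dots> \<le> 0"
  proof -
    have "(\<Sum>x\<in>A. f x * s x) = real (\<Sum>x\<in>A. card (fibre A i x) * card {z\<in>A. z i = x i})"
      by (simp add: f_def s_def)
    also have "\<dots> \<le> N * N"
      using sum_fibre_times_slice_le[OF assms, of i] unfolding N_def of_nat_mult[symmetric] of_nat_le_iff .
    finally show ?thesis using N by (simp add: divide_le_eq)
  qed
  finally show ?thesis
    by (simp add: sum_subtractf f_def s_def N_def)
qed simp

text \<open>Induction on the set of directions, with \<open>A\<close> arbitrary because the
  hypothesis is applied to each slice \<open>z i = a\<close>. The preceding lemma then pays for the
  new direction \<open>i\<close>.\<close>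

lemma sum_ln_fibre_le:
  assumes "finite I" "finite A"
  shows "(\<Sum>i\<in>I. \<Sum>x\<in>A. ln (real (card (fibre A i x)))) \<le> real (card A) * ln (real (card A))"
  using assms
proof (induction I arbitrary: A)
  case empty
  then show ?case by (cases "card A = 0") (auto intro!: mult_nonneg_nonneg ln_ge_zero simp: Suc_le_eq card_gt_0_iff)
next
  case (insert i I)
  let ?S = "\<lambda>a. {z\<in>A. z i = a}"
  note fin = \<open>finite A\<close>
  have "(\<Sum>k\<in>I. \<Sum>x\<in>A. ln (real (card (fibre A k x))))
      = (\<Sum>k\<in>I. \<Sum>a\<in>(\<lambda>x. x i) ` A. \<Sum>x\<in>?S a. ln (real (card (fibre A k x))))"
    by (intro sum.cong refl sum.image_gen fin)
  \<comment> \<open>Moving in a direction \<open>k \<noteq> i\<close> keeps coordinate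
    \<open>i\<close> fixed, so the whole fibre stays inside its slice.\<close>
  also have "\<dots> = (\<Sum>k\<in>I. \<Sum>a\<in>(\<lambda>x. x i) ` A. \<Sum>x\<in>?S a. ln (real (card (fibre (?S a) k x))))"
  proof (intro sum.cong refl)
    fix k a x assume "k \<in> I" "x \<in> ?S a"
    then have "k \<noteq> i" "x i = a" using insert.hyps by auto
    then have "fibre (?S a) k x = fibre A k x"
      unfolding fibre_def by (auto dest: fun_cong[where x = i])
    then show "ln (real (card (fibre A k x))) = ln (real (card (fibre (?S a) k x)))" by simp
  qed
  also have "\<dots> = (\<Sum>a\<in>(\<lambda>x. x i) ` A. \<Sum>k\<in>I. \<Sum>x\<in>?S a. ln (real (card (fibre (?S a) k x))))"
    by (rule sum.swap)
  also have "\<dots> \<le> (\<Sum>a\<in>(\<lambda>x. x i) ` A. real (card (?S a)) * ln (real (card (?S a))))"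
    using fin by (intro sum_mono insert.IH) simp
  also have "\<dots> = (\<Sum>a\<in>(\<lambda>x. x i) ` A. \<Sum>x\<in>?S a. ln (real (card (?S (x i)))))"
    by simp
  also have "\<dots> = (\<Sum>x\<in>A. ln (real (card (?S (x i)))))"
    by (rule sum.image_gen[symmetric, OF fin])
  finally show ?case
    using sum_ln_fibre_slice_le[OF fin, of i] insert.hyps by (simp add: sum.distrib)
qed

section \<open>Edges leaving a vertex set in a single factor\<close>

lemma adjacentD:
  assumes "simple_graph G" "adjacent G u v"
  shows "u \<in> verts G" "v \<in> verts G" "u \<noteq> v"
  using assms unfolding simple_graph_def adjacent_def by fastforce+

lemma connected_graph_leaving_edge:
  assumes "simple_graph G" "connected_graph G" "S \<subseteq> verts G" "S \<noteq> {}" "S \<noteq> verts G"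
  obtains u v where "u \<in> S" "v \<in> verts G - S" "adjacent G u v"
proof -
  obtain s w where s: "s \<in> S" and w: "w \<in> verts G" "w \<notin> S" using assms by blast
  have "(adjacent G)\<^sup>*\<^sup>* s w" using assms s w unfolding connected_graph_def by blast
  \<comment> \<open>At each step of the path, either the previous vertex is already outside
    \<open>S\<close>, or this step leaves \<open>S\<close>.\<close>
  then have "w \<notin> S \<Longrightarrow> \<exists>u v. u \<in> S \<and> v \<notin> S \<and> adjacent G u v"
    using s by (induction rule: rtranclp_induct) blast+
  then show thesis using that w adjacentD[OF assms(1)] by blast
qed

text \<open>The bound 1 is the one edge guaranteed by connectivity. Euler's number enters because s
  ln (1 / s) has maximum 1 / e, attained at s = 1 / e.\<close>

lemma card_ln_le_Max:
  assumes "0 < a" "0 < m" "m \<le> M"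
  shows "a * (exp 1 / M) * ln (m / a) \<le> (1::real)"
proof -
  define t where "t = m / a"
  have "t > 0" using assms by (simp add: t_def)
  \<comment> \<open>This is the tangent to \<open>ln\<close> at e.\<close>
  then have "ln t \<le> t / exp 1"
    using ln_le_minus_one[of "t / exp 1"] by (simp add: ln_div)
  then have "ln (m / a) \<le> m / a / exp 1" by (simp only: t_def)
  then have "a * (exp 1 / M) * ln (m / a) \<le> a * (exp 1 / M) * (m / a / exp 1)"
    using assms by (intro mult_left_mono) auto
  also have "\<dots> = m / M" using assms by simp
  also have "\<dots> \<le> 1" using assms by simp
  finally show ?thesis .
qed

section \<open>Boundary edges sorted by direction\<close>

text \<open>Edges are oriented from \<open>A\<close> outwards: each is counted once, and its first
  component assigns it to a line that meets \<open>A\<close>. Overwriting coordinate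
  \<open>i\<close> with \<open>undefined\<close> on both sides expresses agreement off
  \<open>i\<close>.\<close>

definition dir_boundary :: "(nat \<Rightarrow> 'a) set \<Rightarrow> (nat \<Rightarrow> 'a ugraph) \<Rightarrow> (nat \<Rightarrow> 'a) set \<Rightarrow> nat
    \<Rightarrow> ((nat \<Rightarrow> 'a) \<times> (nat \<Rightarrow> 'a)) set" where
  "dir_boundary V G A i = {(x, y). x \<in> A \<and> y \<in> V - A \<and> adjacent (G i) (x i) (y i)
     \<and> x(i := undefined) = y(i := undefined)}"

lemma finite_dir_boundary:
  assumes "finite V" "A \<subseteq> V"
  shows "finite (dir_boundary V G A i)"
  by (rule finite_subset[of _ "V \<times> V"]) (use assms in \<open>auto simp: dir_boundary_def\<close>)

text \<open>The endpoints of a boundary pair differ in exactly one coordinate, so the directions are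
  disjoint. Forgetting the orientation loses nothing, since only one endpoint lies in
  \<open>A\<close>.\<close>

lemma sum_dir_boundary_le:
  assumes "\<And>i. i \<in> {1..n} \<Longrightarrow> simple_graph (G i)"
    and fin: "finite (verts (product_graph n G))"
    and A: "A \<subseteq> verts (product_graph n G)"
  shows "(\<Sum>i\<in>{1..n}. card (dir_boundary (verts (product_graph n G)) G A i))
    \<le> card (edge_boundary (product_graph n G) A)"
proof -
  let ?V = "verts (product_graph n G)"
  let ?D = "dir_boundary ?V G A"
  have disj: "?D i \<inter> ?D j = {}" if "i \<in> {1..n}" "j \<in> {1..n}" "i \<noteq> j" for i j
  proof -
    have False if "(x, y) \<in> ?D i" "(x, y) \<in> ?D j" for x y
    proof -
      have "x i \<noteq> y i" "x(j := undefined) = y(j := undefined)"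
        using that adjacentD(3)[OF assms(1)[OF \<open>i \<in> {1..n}\<close>]] by (auto simp: dir_boundary_def)
      then show False using \<open>i \<noteq> j\<close> by (metis fun_upd_other)
    qed
    then show ?thesis by auto
  qed
  have "(\<Sum>i\<in>{1..n}. card (?D i)) = card (\<Union>i\<in>{1..n}. ?D i)"
    using disj finite_dir_boundary[OF fin A] by (intro card_UN_disjoint[symmetric]) auto
  also have "\<dots> \<le> card (edge_boundary (product_graph n G) A)"
  proof (rule card_inj_on_le)
    show "inj_on (\<lambda>(x, y). {x, y}) (\<Union>i\<in>{1..n}. ?D i)"
      by (auto simp: inj_on_def dir_boundary_def doubleton_eq_iff)
    show "(\<lambda>(x, y). {x, y}) ` (\<Union>i\<in>{1..n}. ?D i) \<subseteq> edge_boundary (product_graph n G) A"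
    proof safe
      fix i x y assume i: "i \<in> {1..n}" and xy: "(x, y) \<in> ?D i"
      have eq: "x l = y l" if "l \<noteq> i" for l
        using xy that by (auto simp: dir_boundary_def dest: fun_cong[where x = l])
      have "{x, y} \<inter> A = {x}" using xy by (auto simp: dir_boundary_def)
      moreover have "{x, y} \<in> edges (product_graph n G)"
      proof -
        have "\<exists>j\<in>{1..n}. adjacent (G j) (x j) (y j) \<and> (\<forall>l\<in>{1..n}. l \<noteq> j \<longrightarrow> x l = y l)"
          using xy eq by (intro bexI[OF _ i]) (auto simp: dir_boundary_def)
        moreover have "x \<in> ?V" "y \<in> ?V"
          using xy A by (auto simp: dir_boundary_def)
        ultimately show ?thesis
          unfolding product_graph_def ugraph.select_convs by (intro CollectI exI[of _ x] exI[of _ y] conjI refl)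
      qed
      ultimately show "{x, y} \<in> edge_boundary (product_graph n G) A"
        by (simp add: edge_boundary_def)
    qed
    have "edges (product_graph n G) \<subseteq> Pow ?V"
      by (auto simp: product_graph_def)
    then show "finite (edge_boundary (product_graph n G) A)"
      using fin by (auto simp: edge_boundary_def intro: finite_subset)
  qed
  finally show ?thesis .
qed

text \<open>Both sides split over the lines in direction \<open>i\<close>, labelled by
  \<open>?g\<close>. A line contained in \<open>A\<close> contributes \<open>ln 1 = 0\<close> on the
  left; any other line meeting \<open>A\<close> contributes at most 1 there and has at least one
  boundary pair.\<close>

lemma dir_boundary_ge:
  fixes M :: real
  assumes i: "i \<in> {1..n}" and G: "simple_graph (G i)" "connected_graph (G i)"
    and finG: "finite (verts (G i))" and M: "real (card (verts (G i))) \<le> M"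
    and fin: "finite (verts (product_graph n G))"
    and A: "A \<subseteq> verts (product_graph n G)"
  shows "(\<Sum>x\<in>A. exp 1 / M * ln (real (card (verts (G i))) / real (card (fibre A i x))))
    \<le> real (card (dir_boundary (verts (product_graph n G)) G A i))"
proof -
  let ?V = "verts (product_graph n G)"
  let ?D = "dir_boundary ?V G A i"
  let ?g = "\<lambda>x :: nat \<Rightarrow> 'a. x(i := undefined)"
  let ?m = "real (card (verts (G i)))"
  have finA: "finite A" using fin A finite_subset by blast
  note finD = finite_dir_boundary[OF fin A]
  have line: "(\<Sum>x\<in>{x\<in>A. ?g x = p}. exp 1 / M * ln (?m / real (card (fibre A i x))))
      \<le> real (card {e\<in>?D. ?g (fst e) = p})" if p: "p \<in> ?g ` A" for p
  proof -
    obtain x where x: "x \<in> A" "p = ?g x" using p by auto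
    define F where "F = {x\<in>A. ?g x = p}"
    define S where "S = {v \<in> verts (G i). x(i := v) \<in> A}"
    have V: "x(i := v) \<in> ?V \<longleftrightarrow> v \<in> verts (G i)" for v
      using x(1) A i by (auto simp: product_graph_def PiE_iff extensional_def)
    \<comment> \<open>The part of \<open>A\<close> on the line is a copy of the vertex set
      \<open>S\<close> of \<open>G i\<close>, so the fibre size is \<open>card S\<close>.\<close>
    have "F = (\<lambda>v. x(i := v)) ` S"
    proof
      show "(\<lambda>v. x(i := v)) ` S \<subseteq> F" using x by (auto simp: F_def S_def)
      show "F \<subseteq> (\<lambda>v. x(i := v)) ` S"
      proof
        fix y assume y: "y \<in> F"
        then have "x(i := y i) = y"
          using x by (auto simp: F_def) (metis fun_upd_triv fun_upd_upd)
        moreover from this y have "y i \<in> S"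
          using V[of "y i"] A by (auto simp: F_def S_def)
        ultimately show "y \<in> (\<lambda>v. x(i := v)) ` S" by (metis image_eqI)
      qed
    qed
    moreover have "inj_on (\<lambda>v. x(i := v)) S" by (metis fun_upd_same inj_onI)
    ultimately have cF: "card F = card S" by (simp add: card_image)
    have Ff: "fibre A i y = F" if "y \<in> F" for y
      using that by (auto simp: fibre_def F_def)
    have xi: "x i \<in> S" using V[of "x i"] x A by (auto simp: S_def)
    have S: "S \<subseteq> verts (G i)" "finite S" using finG by (auto simp: S_def)
    have cS: "card S > 0" using xi S by (auto simp: card_gt_0_iff)
    have m: "?m > 0" using xi S finG by (auto simp: card_gt_0_iff)
    have "(\<Sum>y\<in>F. exp 1 / M * ln (?m / real (card (fibre A i y))))
        = real (card S) * (exp 1 / M) * ln (?m / real (card S))"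
      by (simp add: Ff cF)
    also have "\<dots> \<le> real (card {e\<in>?D. ?g (fst e) = p})"
    proof (cases "S = verts (G i)")
      case True
      then show ?thesis using m by simp
    next
      case False
      obtain u v where uv: "u \<in> S" "v \<in> verts (G i) - S" "adjacent (G i) u v"
        using connected_graph_leaving_edge[OF G S(1) _ False] xi by blast
      \<comment> \<open>The edge of \<open>G i\<close> leaving \<open>S\<close> is lifted to the
        line through \<open>x\<close>.\<close>
      have "(x(i := u), x(i := v)) \<in> {e\<in>?D. ?g (fst e) = p}"
        using uv V[of v] x by (auto simp: dir_boundary_def S_def)
      then have "card {e\<in>?D. ?g (fst e) = p} > 0"
        using finD by (subst card_gt_0_iff) auto
      moreover have "real (card S) * (exp 1 / M) * ln (?m / real (card S)) \<le> 1"
        using cS m M by (intro card_ln_le_Max) auto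
      ultimately show ?thesis by linarith
    qed
    finally show ?thesis by (simp add: F_def)
  qed
  have "(\<Sum>x\<in>A. exp 1 / M * ln (?m / real (card (fibre A i x))))
      = (\<Sum>p\<in>?g ` A. \<Sum>x\<in>{x\<in>A. ?g x = p}. exp 1 / M * ln (?m / real (card (fibre A i x))))"
    by (rule sum.image_gen[OF finA])
  also have "\<dots> \<le> (\<Sum>p\<in>?g ` A. real (card {e\<in>?D. ?g (fst e) = p}))"
    by (intro sum_mono line)
  also have "\<dots> = (\<Sum>p\<in>?g ` A. \<Sum>e\<in>{e\<in>?D. ?g (fst e) = p}. 1)"
    by simp
  also have "\<dots> = (\<Sum>e\<in>?D. 1)"
    using finA finD by (intro sum.group) (auto simp: dir_boundary_def)
  finally show ?thesis by simp
qed

theorem mainTheorem4: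
  fixes n :: nat
    and G :: "nat \<Rightarrow> 'a ugraph"
    and d m :: "nat \<Rightarrow> nat"
    and A :: "(nat \<Rightarrow> 'a) set"
  assumes "n \<ge> 1"
    and "\<And>i. i \<in> {1..n} \<Longrightarrow> simple_graph (G i)"
    and "\<And>i. i \<in> {1..n} \<Longrightarrow> connected_graph (G i)"
    and "\<And>i. i \<in> {1..n} \<Longrightarrow> regular_graph (G i) (d i)"
    and "\<And>i. i \<in> {1..n} \<Longrightarrow> finite (verts (G i)) \<and> card (verts (G i)) = m i"
    and "A \<subseteq> verts (product_graph n G)"
    and "A \<noteq> {}"
  shows "real (card (edge_boundary (product_graph n G) A)) \<ge>
    real (card A) * (exp 1 / real (Max (m ` {1..n}))) *
      ln (real (card (verts (product_graph n G))) / real (card A))"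
proof -
  let ?V = "verts (product_graph n G)"
  define M where "M = real (Max (m ` {1..n}))"
  have fin: "finite ?V" using assms(5) by (auto simp: product_graph_def intro!: finite_PiE)
  have finA: "finite A" using fin assms(6) finite_subset by blast
  have cA: "card A > 0" using finA assms(7) by (simp add: card_gt_0_iff)
  \<comment> \<open>Connectedness includes having a vertex. Positivity lets the logarithm of the
    product of the \<open>m i\<close> split into a sum.\<close>
  have mpos: "m i > 0" if "i \<in> {1..n}" for i
    using assms(3)[OF that] assms(5)[OF that] by (metis card_gt_0_iff connected_graph_def)
  have cV: "card ?V = (\<Prod>i\<in>{1..n}. m i)"
    using assms(5) by (simp add: product_graph_def card_PiE)
  have "card A * ln (card ?V / card A)
      = (\<Sum>i\<in>{1..n}. \<Sum>x\<in>A. ln (m i)) - card A * ln (card A)"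
  proof -
    have "ln (card ?V) = (\<Sum>i\<in>{1..n}. ln (m i))"
      unfolding cV of_nat_prod by (rule ln_prod) (use mpos in force)+
    moreover have "card ?V > 0" unfolding cV by (rule prod_pos) (use mpos in simp)
    ultimately show ?thesis
      using cA by (simp add: ln_div sum_distrib_left right_diff_distrib)
  qed
  \<comment> \<open>The entropy inequality replaces the global term
    \<open>card A * ln (card A)\<close> by fibre terms, which pair with the \<open>ln (m i)\<close>
    direction by direction.\<close>
  also have "\<dots> \<le> (\<Sum>i\<in>{1..n}. \<Sum>x\<in>A. ln (m i)) - (\<Sum>i\<in>{1..n}. \<Sum>x\<in>A. ln (card (fibre A i x)))"
    using sum_ln_fibre_le[OF _ finA, of "{1..n}"] by simp
  also have "\<dots> = (\<Sum>i\<in>{1..n}. \<Sum>x\<in>A. ln (m i / card (fibre A i x)))"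
    unfolding sum_subtractf[symmetric]
    using mpos card_fibre_pos[OF finA] by (intro sum.cong refl) (simp add: ln_div)
  finally have "exp 1 / M * (card A * ln (card ?V / card A))
      \<le> exp 1 / M * (\<Sum>i\<in>{1..n}. \<Sum>x\<in>A. ln (m i / card (fibre A i x)))"
    by (intro mult_left_mono) (auto simp: M_def)
  also have "\<dots> = (\<Sum>i\<in>{1..n}. \<Sum>x\<in>A. exp 1 / M * ln (m i / card (fibre A i x)))"
    by (simp add: sum_distrib_left)
  also have "\<dots> \<le> (\<Sum>i\<in>{1..n}. real (card (dir_boundary ?V G A i)))"
  proof (rule sum_mono)
    fix i assume i: "i \<in> {1..n}"
    have "real (m i) \<le> M" using i by (auto simp: M_def)
    then show "(\<Sum>x\<in>A. exp 1 / M * ln (m i / card (fibre A i x))) \<le> card (dir_boundary ?V G A i)"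
      using dir_boundary_ge[OF i assms(2,3)[OF i] _ _ fin assms(6), of M] assms(5)[OF i] by simp
  qed
  also have "\<dots> \<le> card (edge_boundary (product_graph n G) A)"
    using sum_dir_boundary_le[OF assms(2) fin assms(6)] unfolding of_nat_sum[symmetric] of_nat_le_iff .
  finally show ?thesis by (simp add: M_def mult_ac)
qed

end
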